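(* Let $f\in\mathcal Q^n$. For $\rho>0$ let $f_\rho(x)=\sup_{y\in B_\rho(x)}f(y)$, $x\in\mathbb R^n$, where $B_\rho(x)=\{y\in\mathbb R^n:\|y-x\|\le\rho\}$. Then for every $\rho>0$, $$I(f_\rho)=\sum_{i=0}^n\binom{n}{i}W_i(f)\,\rho^i$$ (as an identity in $[0,+\infty]$).
   Context: $\mathcal Q^n$ is the set of functions $f:\mathbb R^n\to[0,+\infty]$ that are not identically zero, quasi-concave (i.e. $f((1-\lambda)x_0+\lambda x_1)\ge\min\{f(x_0),f(x_1)\}$ for all $x_0,x_1$ and $\lambda\in[0,1]$), upper semicontinuous, and satisfy $\lim_{\|x\|\to+\infty}f(x)=0$. For such $f$ and $t>0$ the set $\{f\ge t\}$ is convex and compact (possibly empty). For a non-empty compact convex set $K\subset\mathbb R^n$, the quermassintegrals $W_i(K)$, $i=0,\dots,n$, are defined by $\mathcal H^n(K+\rho B)=\sum_{i=0}^n\binom ni W_i(K)\rho^i$ for all $\rho\ge0$, where $B$ is the closed Euclidean unit ball and $\mathcal H^n$ is Lebesgue measure; put $W_i(\emptyset)=0$. For $f\in\mathcal Q^n$, $W_i(f)=\int_0^{+\infty}W_i(\{f\ge t\})\,dt\in[0,+\infty]$. $I(f)=\int_{\mathbb R^n}f(x)\,dx$. *)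

theory Defs
  imports "HOL-Analysis.Analysis"
begin

definition quasi_concave :: "('a::real_vector \<Rightarrow> ennreal) \<Rightarrow> bool" where
  "quasi_concave f \<longleftrightarrow>
     (\<forall>x0 x1. \<forall>l\<in>{0..1::real}. min (f x0) (f x1) \<le> f ((1 - l) *\<^sub>R x0 + l *\<^sub>R x1))"

definition upper_semicontinuous :: "('a::topological_space \<Rightarrow> ennreal) \<Rightarrow> bool" where
  "upper_semicontinuous f \<longleftrightarrow> (\<forall>x c. f x < c \<longrightarrow> (\<forall>\<^sub>F y in nhds x. f y < c))"

definition Q_class :: "(real ^ 'n \<Rightarrow> ennreal) set" where
  "Q_class = {f. (\<exists>x. f x \<noteq> 0) \<and> quasi_concave f \<and> upper_semicontinuous f
     \<and> (f \<longlongrightarrow> 0) at_infinity}"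

(* For a non-empty compact convex set K, the coefficients w are unique because a polynomial
   is determined by its values on the nonnegative reals; their existence is Steiner's formula.
   The condition w i = 0 for i > n only makes the description of w as a function on all of nat
   unique. The sum of sets is the Minkowski sum from HOL-Library.Set_Algebras. *)
definition quermassintegral :: "nat \<Rightarrow> (real ^ 'n) set \<Rightarrow> real" where
  "quermassintegral i K = (if K = {} then 0 else
     (THE w :: nat \<Rightarrow> real. (\<forall>i > CARD('n). w i = 0) \<and>
        (\<forall>\<rho> \<ge> 0. measure lborel (K + (\<lambda>x. \<rho> *\<^sub>R x) ` cball 0 1)
                = (\<Sum>i\<le>CARD('n). of_nat (CARD('n) choose i) * w i * \<rho> ^ i))) i)"

(* The coercion ennreal truncates negative reals, but quermassintegrals are nonnegative. *)
definition quermassintegral_fun :: "nat \<Rightarrow> (real ^ 'n \<Rightarrow> ennreal) \<Rightarrow> ennreal" where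
  "quermassintegral_fun i f =
     (\<integral>\<^sup>+ t \<in> {0::real<..}. ennreal (quermassintegral i {x. ennreal t \<le> f x}) \<partial>lborel)"

definition I_fun :: "(real ^ 'n \<Rightarrow> ennreal) \<Rightarrow> ennreal" where
  "I_fun f = (\<integral>\<^sup>+ x. f x \<partial>lborel)"

definition sup_enlargement :: "real \<Rightarrow> (real ^ 'n \<Rightarrow> ennreal) \<Rightarrow> real ^ 'n \<Rightarrow> ennreal" where
  "sup_enlargement \<rho> f x = (SUP y \<in> cball x \<rho>. f y)"

end

theory Submission
  imports Defs
begin

text \<open>
  The superlevel sets of the enlarged function are the parallel bodies \<open>K + \<rho> B\<close> of the superlevel sets \<open>K\<close>
  of \<open>f\<close> (\<open>superlevel_sup_enlargement\<close>), and the integral of a nonnegative function is the integral over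
  the levels of the volumes of its superlevel sets (\<open>layer_cake\<close>). So the formula for functions is Steiner's
  formula for the convex bodies \<open>K\<close>, integrated over the levels. The integral can be taken term by term in
  \<open>[0, \<infinity>]\<close> because the quermassintegrals are nonnegative and depend measurably on the level.

  The main work is Steiner's formula with nonnegative coefficients (\<open>steiner_formula\<close>). It is proved here
  with zonotopes, that is, finite Minkowski sums of segments. The volume of \<open>K + [0, t v]\<close> is affine in \<open>t\<close>,
  since lengthening the segment repeatedly adds translates of one and the same set (\<open>volume_plus_segment\<close>).
  Adding the segments of a zonotope \<open>Z\<close> one after another shows that the volume of \<open>K + \<rho> Z\<close> is a
  polynomial in \<open>\<rho>\<close>. Its coefficients are sums of iterated slopes, which are nonnegative because an affine function that is
  nonnegative on a half-line has a nonnegative slope (\<open>segment_affine_polynomial\<close>), and its degree is at most the dimension by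
  the growth of the volume.

  The unit ball is a limit of zonotopes (\<open>zonotope_approx_cball\<close>): by rotation invariance of Lebesgue measure
  the support function of the ball is a mean of support functions of segments, and a finite sum approximates this
  mean. The polynomials for the approximating zonotopes converge to the volume of \<open>K + \<rho> B\<close>, and
  since their degrees are bounded, the limit is a polynomial with nonnegative coefficients.

  The coefficients of a polynomial are linear combinations of finitely many of its values
  (\<open>vandermonde_inverse\<close>). Therefore the quermassintegrals are linear combinations of volumes of
  parallel bodies, and they inherit from those the measurability in the level.
\<close>

section \<open>Adding a segment changes the volume affinely\<close>

text \<open>
  Nonnegativity makes \<open>g\<close> monotone, so \<open>g (m t) = m g t\<close> lies between the values of \<open>g\<close> at the two integers
  next to \<open>m t\<close>. This determines \<open>g t\<close> up to \<open>g 1 / m\<close>.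
\<close>

lemma additive_nonneg_imp_linear:
  fixes g :: "real \<Rightarrow> real"
  assumes add: "\<And>s t. 0 \<le> s \<Longrightarrow> 0 \<le> t \<Longrightarrow> g (s + t) = g s + g t"
    and nonneg: "\<And>t. 0 \<le> t \<Longrightarrow> 0 \<le> g t"
    and "0 \<le> t"
  shows "g t = t * g 1"
proof -
  have mono: "g s \<le> g t" if "0 \<le> s" "s \<le> t" for s t
    using add[of s "t - s"] nonneg[of "t - s"] that by simp
  have mult: "g (real m * s) = real m * g s" if "0 \<le> s" for m s
    using that add[of 0 0] by (induction m) (simp_all add: add algebra_simps)
  have bound: "real m * \<bar>g t - t * g 1\<bar> \<le> g 1" for m :: nat
  proof -
    define k where "k = nat \<lfloor>real m * t\<rfloor>"
    have k: "real k \<le> real m * t" "real m * t \<le> real (Suc k)"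
      using \<open>0 \<le> t\<close> unfolding k_def by (simp_all add: of_nat_nat) linarith
    have "real k * g 1 \<le> real m * g t"
      using mono[of "real k" "real m * t"] k mult[of t m] mult[of 1 k] \<open>0 \<le> t\<close> by simp
    moreover have "real m * g t \<le> real (Suc k) * g 1"
      using mono[of "real m * t" "real (Suc k)"] k mult[of t m] mult[of 1 "Suc k"] \<open>0 \<le> t\<close> by simp
    moreover have "real k * g 1 \<le> real m * t * g 1" "real m * t * g 1 \<le> real (Suc k) * g 1"
      using k nonneg[of 1] by (auto intro: mult_right_mono)
    ultimately have "\<bar>real m * g t - real m * t * g 1\<bar> \<le> g 1"
      by (auto simp: abs_if algebra_simps)
    moreover have "\<bar>real m * g t - real m * t * g 1\<bar> = real m * \<bar>g t - t * g 1\<bar>"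
      by (metis abs_mult abs_of_nat mult.assoc right_diff_distrib)
    ultimately show ?thesis by simp
  qed
  show ?thesis
  proof (rule ccontr)
    assume "g t \<noteq> t * g 1"
    then obtain m :: nat where "g 1 < real m * \<bar>g t - t * g 1\<bar>"
      using reals_Archimedean3[of "\<bar>g t - t * g 1\<bar>"] by auto
    with bound[of m] show False by simp
  qed
qed

lemma compact_set_plus:
  fixes A B :: "'a::real_normed_vector set"
  assumes "compact A" "compact B"
  shows "compact (A + B)"
proof -
  have "A + B = {x + y | x y. x \<in> A \<and> y \<in> B}"
    by (auto simp: set_plus_def)
  then show ?thesis
    using compact_sums[OF assms] by simp
qed

lemma compact_set_sum:
  fixes S :: "'i \<Rightarrow> 'a::real_normed_vector set"
  assumes "\<And>i. i \<in> I \<Longrightarrow> compact (S i)"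
  shows "compact (\<Sum>i\<in>I. S i)"
  using assms by (induction I rule: infinite_finite_induct) (auto simp: compact_set_plus)

text \<open>
  This turns membership in \<open>K + [0, t v]\<close> into a question about \<open>K\<close> on a single line parallel to \<open>v\<close>:
  going back from \<open>x\<close> by at most \<open>t v\<close> one has to meet \<open>K\<close>.
\<close>

lemma mem_plus_segment_iff:
  fixes v :: "'a::real_vector"
  assumes "0 \<le> t"
  shows "x \<in> K + closed_segment 0 (t *\<^sub>R v) \<longleftrightarrow> (\<exists>s. 0 \<le> s \<and> s \<le> t \<and> x - s *\<^sub>R v \<in> K)"
proof
  assume "x \<in> K + closed_segment 0 (t *\<^sub>R v)"
  then obtain k u where "k \<in> K" "0 \<le> u" "u \<le> 1" "x = k + u *\<^sub>R t *\<^sub>R v"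
    by (auto simp: set_plus_def in_segment)
  then show "\<exists>s. 0 \<le> s \<and> s \<le> t \<and> x - s *\<^sub>R v \<in> K"
    using assms by (intro exI[of _ "u * t"]) (auto simp: mult_left_le_one_le)
next
  assume "\<exists>s. 0 \<le> s \<and> s \<le> t \<and> x - s *\<^sub>R v \<in> K"
  then obtain s where s: "0 \<le> s" "s \<le> t" "x - s *\<^sub>R v \<in> K" by blast
  have "s *\<^sub>R v \<in> closed_segment 0 (t *\<^sub>R v)"
    unfolding in_segment using s by (intro exI[of _ "s / t"]) (auto simp: divide_simps)
  then have "(x - s *\<^sub>R v) + s *\<^sub>R v \<in> K + closed_segment 0 (t *\<^sub>R v)"
    using s(3) by (rule set_plus_intro[rotated])
  then show "x \<in> K + closed_segment 0 (t *\<^sub>R v)" by simp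
qed

text \<open>
  On each line parallel to \<open>v\<close>, a convex set \<open>K\<close> is an interval, and adding \<open>[0, t v]\<close> prolongs that
  interval at its far end by \<open>t\<close>. So what the second prolongation, from \<open>s\<close> to \<open>s + t\<close>, adds is what the
  prolongation of \<open>K\<close> by \<open>t\<close> adds, shifted by \<open>s v\<close>. Convexity is what excludes a gap of \<open>K\<close> that the
  segments would fill at different times.
\<close>

lemma plus_segment_diff_eq_translate:
  fixes v :: "'a::real_vector"
  assumes "convex K" "0 \<le> s" "0 \<le> t"
  shows "(K + closed_segment 0 ((s + t) *\<^sub>R v)) - (K + closed_segment 0 (s *\<^sub>R v))
       = (+) (s *\<^sub>R v) ` ((K + closed_segment 0 (t *\<^sub>R v)) - K)"
    (is "?L = ?R")
proof (intro equalityI subsetI)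
  fix x assume x: "x \<in> ?L"
  then obtain r where r: "0 \<le> r" "r \<le> s + t" "x - r *\<^sub>R v \<in> K"
    using assms by (auto simp: mem_plus_segment_iff)
  have out: "x - q *\<^sub>R v \<notin> K" if "0 \<le> q" "q \<le> s" for q
    using x that assms by (auto simp: mem_plus_segment_iff)
  have "s < r" using out[of r] r by force
  then have "x - s *\<^sub>R v \<in> K + closed_segment 0 (t *\<^sub>R v)"
    using r assms by (auto simp: mem_plus_segment_iff algebra_simps intro!: exI[of _ "r - s"])
  then have "x - s *\<^sub>R v \<in> (K + closed_segment 0 (t *\<^sub>R v)) - K"
    using out[of s] assms by simp
  then show "x \<in> ?R" by (rule rev_image_eqI) simp
next
  fix x assume "x \<in> ?R"
  then obtain y r where x: "x = s *\<^sub>R v + y" and "y \<notin> K"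
    and r: "0 \<le> r" "r \<le> t" "y - r *\<^sub>R v \<in> K"
    using assms by (auto simp: mem_plus_segment_iff)
  have "x \<in> K + closed_segment 0 ((s + t) *\<^sub>R v)"
    unfolding mem_plus_segment_iff[OF add_nonneg_nonneg[OF assms(2,3)]]
    using r assms x by (intro exI[of _ "s + r"]) (auto simp: algebra_simps)
  moreover have "x \<notin> K + closed_segment 0 (s *\<^sub>R v)"
  proof
    assume "x \<in> K + closed_segment 0 (s *\<^sub>R v)"
    then obtain q where q: "0 \<le> q" "q \<le> s" "x - q *\<^sub>R v \<in> K"
      using assms by (auto simp: mem_plus_segment_iff)
    then have q': "y + (s - q) *\<^sub>R v \<in> K" by (simp add: x algebra_simps)
    have "y \<in> closed_segment (y - r *\<^sub>R v) (y + (s - q) *\<^sub>R v)"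
    proof (cases "r + (s - q) = 0")
      case True
      then have "r = 0" "s = q" using r q by auto
      then show ?thesis by simp
    next
      case False
      define u where "u = r / (r + (s - q))"
      have "(1 - u) *\<^sub>R (y - r *\<^sub>R v) + u *\<^sub>R (y + (s - q) *\<^sub>R v)
          = y + (u * (s - q) - (1 - u) * r) *\<^sub>R v"
        by (simp add: algebra_simps)
      also have "u * (s - q) - (1 - u) * r = 0"
        using False by (simp add: u_def field_simps)
      finally have "(1 - u) *\<^sub>R (y - r *\<^sub>R v) + u *\<^sub>R (y + (s - q) *\<^sub>R v) = y"
        by simp
      moreover have "0 \<le> u" "u \<le> 1"
        using r q False by (auto simp: u_def divide_simps)
      ultimately show ?thesis
        unfolding in_segment by metis
    qed
    then have "y \<in> K"
      using \<open>convex K\<close> r q' closed_segment_subset by blast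
    with \<open>y \<notin> K\<close> show False ..
  qed
  ultimately show "x \<in> ?L" by simp
qed

lemma measure_lborel_translation:
  fixes A :: "'a::euclidean_space set"
  assumes "A \<in> sets borel"
  shows "measure lborel ((+) a ` A) = measure lborel A"
proof -
  have "(+) a ` A = (\<lambda>x. - a + x) -` A"
    by (auto simp: image_iff intro!: bexI[of _ "- a + _"])
  also have "\<dots> \<in> sets borel"
    using assms by (auto intro!: measurable_sets_borel[of _ borel])
  finally show ?thesis
    using measure_translation[of a A] assms by simp
qed

lemma compact_in_fmeasurable_lborel:
  fixes K :: "'a::euclidean_space set"
  shows "compact K \<Longrightarrow> K \<in> fmeasurable lborel"
  by (intro fmeasurableI) (simp_all add: emeasure_compact_finite[unfolded infinity_ennreal_def] borel_compact)

lemma subset_set_plus_segment: "K \<subseteq> K + closed_segment 0 v"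
  by (metis add.right_neutral ends_in_segment(1) set_plus_intro subsetI)

text \<open>
  By \<open>plus_segment_diff_eq_translate\<close> and translation invariance, the volume gained by adding \<open>[0, (s + t) v]\<close> is the sum of the
  gains for \<open>[0, s v]\<close> and \<open>[0, t v]\<close>; a nonnegative additive function of \<open>t\<close> is linear.
\<close>

lemma volume_plus_segment:
  fixes K :: "'a::euclidean_space set"
  assumes K: "compact K" "convex K" and "0 \<le> t"
  shows "measure lborel (K + closed_segment 0 (t *\<^sub>R v))
       = measure lborel K + t * (measure lborel (K + closed_segment 0 v) - measure lborel K)"
proof -
  define L where "L t = K + closed_segment 0 (t *\<^sub>R v)" for t
  define g where "g t = measure lborel (L t) - measure lborel K" for t
  have fin: "L t \<in> fmeasurable lborel" for t
    unfolding L_def by (intro compact_in_fmeasurable_lborel compact_set_plus K) auto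
  have K_fin: "K \<in> fmeasurable lborel"
    by (rule compact_in_fmeasurable_lborel[OF K(1)])
  have borel: "K \<in> sets borel" "L t \<in> sets borel" for t
    using fmeasurableD[OF K_fin] fmeasurableD[OF fin[of t]] by simp_all
  have sub: "K \<subseteq> L t" for t
    unfolding L_def by (rule subset_set_plus_segment)
  have sub_L: "L s \<subseteq> L (s + t)" if "0 \<le> s" "0 \<le> t" for s t
    unfolding L_def using that by (force simp: mem_plus_segment_iff)
  have "measure lborel (L (s + t)) - measure lborel (L s) = measure lborel (L t) - measure lborel K"
    if "0 \<le> s" "0 \<le> t" for s t
  proof -
    have "measure lborel (L (s + t)) - measure lborel (L s) = measure lborel (L (s + t) - L s)"
      using fin sub_L[OF that] by (intro measurable_measure_Diff[symmetric]) (auto simp: borel)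
    also have "L (s + t) - L s = (+) (s *\<^sub>R v) ` (L t - K)"
      unfolding L_def by (rule plus_segment_diff_eq_translate[OF K(2) that])
    also have "measure lborel \<dots> = measure lborel (L t - K)"
      using borel by (intro measure_lborel_translation) auto
    also have "\<dots> = measure lborel (L t) - measure lborel K"
      using fin K_fin sub by (intro measurable_measure_Diff) (auto simp: borel)
    finally show ?thesis .
  qed
  then have add: "g (s + t) = g s + g t" if "0 \<le> s" "0 \<le> t" for s t
    unfolding g_def using that by (smt (verit))
  have "measure lborel K \<le> measure lborel (L t)" for t
    using fin K_fin sub by (intro measure_mono_fmeasurable) (auto simp: borel)
  then have "g t = t * g 1"
    using \<open>0 \<le> t\<close> by (intro additive_nonneg_imp_linear add) (simp_all add: g_def)
  then show ?thesis by (simp add: L_def g_def)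
qed

section \<open>Volumes of sums with zonotopes are polynomials\<close>

text \<open>
  The class of functionals on compact convex sets on which the induction over the segments of a zonotope runs.
  Besides the volume it contains the coefficients that appear when segments are added one after another:
  these are, up to normalisation, mixed volumes with segments.
\<close>

definition segment_affine :: "('a::euclidean_space set \<Rightarrow> real) \<Rightarrow> bool" where
  "segment_affine \<phi> \<longleftrightarrow> (\<forall>K. compact K \<and> convex K \<longrightarrow> 0 \<le> \<phi> K \<and>
     (\<forall>v. \<forall>t\<ge>0. \<phi> (K + closed_segment 0 (t *\<^sub>R v)) = \<phi> K + t * (\<phi> (K + closed_segment 0 v) - \<phi> K)))"

lemma segment_affine_volume: "segment_affine (measure lborel)"
  unfolding segment_affine_def by (auto intro: volume_plus_segment)

text \<open>
  The slope of \<open>\<phi>\<close> in the direction of \<open>v\<close> is again in the class. It is nonnegative because \<open>\<phi>\<close> is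
  nonnegative along the whole half-line of the sets \<open>K + [0, t v]\<close> and an affine function with a
  negative slope is not.
\<close>

lemma segment_affine_diff:
  fixes \<phi> :: "'a::euclidean_space set \<Rightarrow> real"
  assumes "segment_affine \<phi>"
  shows "segment_affine (\<lambda>K. \<phi> (K + closed_segment 0 v) - \<phi> K)"
  unfolding segment_affine_def
proof (intro allI impI conjI)
  fix K :: "'a set" assume K: "compact K \<and> convex K"
  have pos: "0 \<le> \<phi> L" if "compact L" "convex L" for L
    using assms that by (auto simp: segment_affine_def)
  have aff: "\<phi> (L + closed_segment 0 (t *\<^sub>R w)) = \<phi> L + t * (\<phi> (L + closed_segment 0 w) - \<phi> L)"
    if "compact L" "convex L" "0 \<le> t" for L t w
    using assms that by (auto simp: segment_affine_def)
  show "0 \<le> \<phi> (K + closed_segment 0 v) - \<phi> K"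
  proof (rule ccontr)
    assume neg: "\<not> ?thesis"
    define d where "d = \<phi> K - \<phi> (K + closed_segment 0 v)"
    have d: "d > 0" using neg by (simp add: d_def)
    define t where "t = (\<phi> K + 1) / d"
    have "0 \<le> t" using pos[of K] K d by (simp add: t_def)
    then have "\<phi> (K + closed_segment 0 (t *\<^sub>R v)) = \<phi> K + t * - d"
      using aff[of K t v] K by (simp add: d_def)
    also have "\<dots> = - 1" using d by (simp add: t_def)
    finally show False
      using pos[of "K + closed_segment 0 (t *\<^sub>R v)"] K by (simp add: compact_set_plus convex_set_plus)
  qed
  fix w :: 'a and t :: real assume "0 \<le> t"
  have "K + closed_segment 0 (t *\<^sub>R w) + closed_segment 0 v = K + closed_segment 0 v + closed_segment 0 (t *\<^sub>R w)"
    "K + closed_segment 0 w + closed_segment 0 v = K + closed_segment 0 v + closed_segment 0 w"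
    by (simp_all add: ac_simps)
  moreover have "compact (K + closed_segment 0 v)" "convex (K + closed_segment 0 v)"
    using K by (simp_all add: compact_set_plus convex_set_plus)
  ultimately show "\<phi> (K + closed_segment 0 (t *\<^sub>R w) + closed_segment 0 v) - \<phi> (K + closed_segment 0 (t *\<^sub>R w))
    = \<phi> (K + closed_segment 0 v) - \<phi> K
      + t * (\<phi> (K + closed_segment 0 w + closed_segment 0 v) - \<phi> (K + closed_segment 0 w)
             - (\<phi> (K + closed_segment 0 v) - \<phi> K))"
    using K \<open>0 \<le> t\<close>
    by (simp only: aff[of K] aff[of "K + closed_segment 0 v"]) (simp add: algebra_simps)
qed

text \<open>
  Splitting off one segment gives \<open>\<phi> (L + [0, \<rho> v]) = \<phi> L + \<rho> \<psi> L\<close>, where \<open>\<psi>\<close> is the slope of \<open>\<phi>\<close>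
  in the direction of \<open>v\<close>. Both \<open>\<phi>\<close> and \<open>\<psi>\<close> are covered by the induction hypothesis, which for this reason
  has to range over all functionals of the class; all coefficients stay nonnegative.
\<close>

lemma segment_affine_polynomial:
  fixes \<phi> :: "'a::euclidean_space set \<Rightarrow> real" and w :: "'i \<Rightarrow> 'a"
  assumes "finite I" "segment_affine \<phi>" "compact K" "convex K"
  shows "\<exists>p. (\<forall>i. 0 \<le> coeff p i) \<and>
    (\<forall>\<rho>\<ge>0. \<phi> (K + (\<Sum>j\<in>I. closed_segment 0 (\<rho> *\<^sub>R w j))) = poly p \<rho>)"
  using assms
proof (induction I arbitrary: \<phi> rule: finite_induct)
  case empty
  then have "0 \<le> \<phi> K" by (simp add: segment_affine_def)
  then show ?case
    by (intro exI[of _ "[:\<phi> K:]"]) (auto simp: coeff_pCons split: nat.split)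
next
  case (insert x I)
  define \<psi> where "\<psi> L = \<phi> (L + closed_segment 0 (w x)) - \<phi> L" for L
  have "segment_affine \<psi>"
    unfolding \<psi>_def by (rule segment_affine_diff[OF insert.prems(1)])
  then obtain q where q: "\<forall>i. 0 \<le> coeff q i"
    "\<forall>\<rho>\<ge>0. \<psi> (K + (\<Sum>j\<in>I. closed_segment 0 (\<rho> *\<^sub>R w j))) = poly q \<rho>"
    using insert.IH[of \<psi>] insert.prems by blast
  obtain p where p: "\<forall>i. 0 \<le> coeff p i"
    "\<forall>\<rho>\<ge>0. \<phi> (K + (\<Sum>j\<in>I. closed_segment 0 (\<rho> *\<^sub>R w j))) = poly p \<rho>"
    using insert.IH[of \<phi>] insert.prems by blast
  have "\<phi> (K + (\<Sum>j\<in>insert x I. closed_segment 0 (\<rho> *\<^sub>R w j))) = poly (p + pCons 0 q) \<rho>" if "0 \<le> \<rho>" for \<rho>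
  proof -
    define L where "L = K + (\<Sum>j\<in>I. closed_segment 0 (\<rho> *\<^sub>R w j))"
    have "compact L" "convex L"
      unfolding L_def using insert.prems
      by (auto intro!: compact_set_plus compact_set_sum convex_set_plus convex_set_sum)
    have "\<phi> (K + (\<Sum>j\<in>insert x I. closed_segment 0 (\<rho> *\<^sub>R w j))) = \<phi> (L + closed_segment 0 (\<rho> *\<^sub>R w x))"
      using insert.hyps by (simp add: L_def ac_simps)
    also have "\<dots> = \<phi> L + \<rho> * \<psi> L"
      using insert.prems(1) \<open>compact L\<close> \<open>convex L\<close> that unfolding segment_affine_def \<psi>_def by blast
    also have "\<dots> = poly (p + pCons 0 q) \<rho>"
      using p q that by (simp add: L_def)
    finally show ?thesis .
  qed
  moreover have "\<forall>i. 0 \<le> coeff (p + pCons 0 q) i"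
    using p q by (auto simp: coeff_pCons split: nat.split)
  ultimately show ?case by blast
qed

text \<open>
  The induction over the segments bounds the degree only by their number. The bound by the dimension
  comes from the growth of the volume, and as the coefficients are nonnegative, the leading term cannot
  be compensated by other terms.
\<close>

lemma degree_le_of_growth:
  fixes p :: "real poly"
  assumes nonneg: "\<And>i. 0 \<le> coeff p i"
    and growth: "\<And>x. 1 \<le> x \<Longrightarrow> poly p x \<le> C * x ^ n"
  shows "degree p \<le> n"
proof (rule ccontr)
  assume "\<not> degree p \<le> n"
  define c where "c = coeff p (degree p)"
  have "p \<noteq> 0" using \<open>\<not> degree p \<le> n\<close> by auto
  then have c: "c > 0" using nonneg[of "degree p"] by (simp add: c_def order.strict_iff_order)
  define x where "x = \<bar>C\<bar> / c + 1"
  have x: "1 \<le> x" using c by (simp add: x_def)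
  have "c * x ^ Suc n \<le> c * x ^ degree p"
    using x c \<open>\<not> degree p \<le> n\<close> by (intro mult_left_mono power_increasing) auto
  also have "\<dots> \<le> (\<Sum>i\<le>degree p. coeff p i * x ^ i)"
    unfolding c_def using x nonneg by (intro member_le_sum) auto
  also have "\<dots> \<le> C * x ^ n"
    using growth[OF x] by (simp add: poly_altdef)
  finally have "c * x \<le> C" using x by (simp add: mult.assoc[symmetric])
  moreover have "c * x = \<bar>C\<bar> + c" using c by (simp add: x_def field_simps)
  ultimately show False using c by linarith
qed

section \<open>Rotation invariance of Lebesgue measure\<close>

lemma nn_integral_lborel_translation:
  fixes f :: "'a::euclidean_space \<Rightarrow> ennreal"
  assumes [measurable]: "f \<in> borel_measurable borel"
  shows "(\<integral>\<^sup>+ x. f (a + x) \<partial>lborel) = (\<integral>\<^sup>+ x. f x \<partial>lborel)"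
proof -
  have "(\<integral>\<^sup>+ x. f x \<partial>lborel) = (\<integral>\<^sup>+ x. f x \<partial>distr lborel borel ((+) a))"
    by (simp only: lborel_distr_plus)
  also have "\<dots> = (\<integral>\<^sup>+ x. f (a + x) \<partial>lborel)"
    by (rule nn_integral_distr) simp_all
  finally show ?thesis by simp
qed

text \<open>
  This is the uniqueness argument for Haar measure in a special case. For the unit ball \<open>B\<close>, the product
  of the volumes of the preimage of \<open>A\<close> under \<open>T\<close> and of \<open>B\<close> is a double integral over \<open>x\<close> and \<open>y\<close>, in
  which \<open>y\<close> is translated by \<open>T x\<close>; exchanging the integrals and translating \<open>x\<close> by the preimage of \<open>y\<close>
  moves the roles of the two sets so that the volume of \<open>A\<close> itself appears. The ball is used because it is
  symmetric and mapped to itself by \<open>T\<close>.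
\<close>

lemma lborel_distr_orthogonal_transformation:
  fixes T :: "'a::euclidean_space \<Rightarrow> 'a"
  assumes "orthogonal_transformation T"
  shows "distr lborel borel T = lborel"
proof (rule measure_eqI)
  fix A :: "'a set" assume "A \<in> sets (distr lborel borel T)"
  then have A [measurable]: "A \<in> sets borel" by simp
  have "linear T" and norm_T: "\<And>x. norm (T x) = norm x" and "bij T"
    using assms by (simp_all add: orthogonal_transformation orthogonal_transformation_bij)
  have cont: "continuous_on UNIV T"
    using \<open>linear T\<close> by (simp add: linear_continuous_on linear_conv_bounded_linear)
  then have T [measurable]: "T \<in> borel_measurable borel"
    by (rule borel_measurable_continuous_onI)
  define B :: "'a set" where "B = cball 0 1"
  have B [measurable]: "B \<in> sets borel" by (simp add: B_def)
  define \<nu> where "\<nu> = (\<lambda>S. emeasure (lborel :: 'a measure) S)"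
  have trans: "(\<integral>\<^sup>+ y. indicator S (a + y) \<partial>lborel) = \<nu> S" if [measurable]: "S \<in> sets borel" for S a
    using nn_integral_lborel_translation[of "indicator S" a] that by (simp add: \<nu>_def)
  have "\<nu> (T -` A) * \<nu> B = (\<integral>\<^sup>+ x. indicator A (T x) * \<nu> B \<partial>lborel)"
  proof -
    have "(\<integral>\<^sup>+ x. indicator A (T x) \<partial>lborel) = (\<integral>\<^sup>+ x. indicator (T -` A) x \<partial>lborel)"
      by (simp add: indicator_def)
    also have "\<dots> = \<nu> (T -` A)"
      unfolding \<nu>_def by (rule nn_integral_indicator) (simp add: measurable_sets_borel[OF T A])
    finally show ?thesis by (simp add: nn_integral_multc)
  qed
  also have "\<dots> = (\<integral>\<^sup>+ x. \<integral>\<^sup>+ y. indicator A (T x) * indicator B (- T x + y) \<partial>lborel \<partial>lborel)"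
    by (simp add: nn_integral_cmult trans del: uminus_add_conv_diff)
  also have "\<dots> = (\<integral>\<^sup>+ y. \<integral>\<^sup>+ x. indicator A (T x) * indicator B (- T x + y) \<partial>lborel \<partial>lborel)"
    by (rule lborel_pair.Fubini') simp
  also have "\<dots> = (\<integral>\<^sup>+ y. \<integral>\<^sup>+ x. indicator A (T x + y) * indicator B x \<partial>lborel \<partial>lborel)"
  proof (rule nn_integral_cong)
    fix y
    obtain z where z: "T z = y" using \<open>bij T\<close> by (metis bij_pointE)
    have "(\<integral>\<^sup>+ x. indicator A (T x) * indicator B (- T x + y) \<partial>lborel)
        = (\<integral>\<^sup>+ x. indicator A (T (z + x)) * indicator B (- T (z + x) + y) \<partial>lborel)"
      by (subst nn_integral_lborel_translation) simp_all
    also have "\<dots> = (\<integral>\<^sup>+ x. indicator A (T x + y) * indicator B x \<partial>lborel)"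
      by (intro nn_integral_cong)
        (simp add: linear_add[OF \<open>linear T\<close>] z B_def indicator_def norm_T add.commute)
    finally show "(\<integral>\<^sup>+ x. indicator A (T x) * indicator B (- T x + y) \<partial>lborel)
        = (\<integral>\<^sup>+ x. indicator A (T x + y) * indicator B x \<partial>lborel)" .
  qed
  also have "\<dots> = (\<integral>\<^sup>+ x. \<integral>\<^sup>+ y. indicator A (T x + y) * indicator B x \<partial>lborel \<partial>lborel)"
    by (rule lborel_pair.Fubini') simp
  also have "\<dots> = \<nu> A * \<nu> B"
    by (simp add: nn_integral_multc trans nn_integral_cmult \<nu>_def)
  finally have "\<nu> (T -` A) * \<nu> B = \<nu> A * \<nu> B" .
  moreover have "\<nu> B \<noteq> 0" "\<nu> B \<noteq> top"
    using emeasure_compact_finite[of B] content_cball_gt_0_iff[of "0::'a" 1]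
    by (auto simp: B_def \<nu>_def measure_def)
  ultimately have "\<nu> (T -` A) = \<nu> A"
    by (simp add: mult.commute[of _ "\<nu> B"] ennreal_mult_cancel_left)
  then show "emeasure (distr lborel borel T) A = emeasure lborel A"
    by (simp add: emeasure_distr \<nu>_def)
qed simp

section \<open>Approximation of balls by zonotopes\<close>

text \<open>
  The function \<open>\<lambda>a. max 0 (a \<bullet> u)\<close> is the support function of the segment from \<open>0\<close> to \<open>u\<close>. Its integral
  over all \<open>u\<close> in the ball is positively homogeneous in \<open>a\<close> and invariant under rotations of \<open>a\<close>, hence a
  multiple of the norm, which is the support function of the ball: up to a factor, the ball is a
  continuous sum of segments.
\<close>

lemma integral_max_inner_cball:
  obtains c where "c > 0"
    "\<And>a :: real ^ 'n. (\<integral>u. max 0 (a \<bullet> (indicator (cball 0 1) u *\<^sub>R u)) \<partial>lborel) = c * norm a"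
proof -
  define f :: "real ^ 'n \<Rightarrow> real ^ 'n" where "f u = indicator (cball 0 1) u *\<^sub>R u" for u
  define J where "J a = (\<integral>u. max 0 (a \<bullet> f u) \<partial>lborel)" for a
  have f_int: "integrable lborel f"
    unfolding f_def by (rule borel_integrable_compact) (auto intro: continuous_on_id)
  have [measurable]: "f \<in> borel_measurable borel"
    using f_int by auto
  have max_int: "integrable lborel (\<lambda>u. max 0 (a \<bullet> f u))" for a
    using f_int by (intro integrable_max) auto
  obtain e :: "real ^ 'n" where e: "norm e = 1"
    using vector_choose_size[of 1] by auto
  have J: "J a = J e * norm a" for a
  proof -
    obtain T where T: "orthogonal_transformation T" "T (norm a *\<^sub>R e) = a"
      using orthogonal_transformation_exists[of "norm a *\<^sub>R e" a] e by auto
    have "linear T" and norm_T: "\<And>x. norm (T x) = norm x"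
      using T by (simp_all add: orthogonal_transformation)
    then have [measurable]: "T \<in> borel_measurable borel"
      by (intro borel_measurable_continuous_onI) (simp add: linear_continuous_on linear_conv_bounded_linear)
    have "J a = (\<integral>u. max 0 (a \<bullet> f u) \<partial>distr lborel borel T)"
      unfolding J_def lborel_distr_orthogonal_transformation[OF T(1)] ..
    also have "\<dots> = (\<integral>u. max 0 (a \<bullet> f (T u)) \<partial>lborel)"
      by (rule integral_distr) simp_all
    also have "\<dots> = (\<integral>u. norm a * max 0 (e \<bullet> f u) \<partial>lborel)"
    proof (rule Bochner_Integration.integral_cong[OF refl])
      fix u
      have "f (T u) = T (f u)"
        using \<open>linear T\<close> by (simp add: f_def indicator_def norm_T linear_0)
      then have "a \<bullet> f (T u) = T (norm a *\<^sub>R e) \<bullet> T (f u)" by (simp add: T)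
      also have "\<dots> = norm a * (e \<bullet> f u)"
        using T(1) by (simp add: orthogonal_transformation_def)
      finally show "max 0 (a \<bullet> f (T u)) = norm a * max 0 (e \<bullet> f u)"
        by (simp add: max_mult_distrib_left)
    qed
    finally show ?thesis by (simp add: J_def)
  qed
  \<comment> \<open>The constant is positive, as the integrand is at least \<open>1/4\<close> on this small ball inside the unit ball.\<close>
  define C where "C = cball (e /\<^sub>R 2) (1/4)"
  have "0 < measure lborel C / 4"
    by (simp add: C_def)
  also have "\<dots> = (\<integral>u. indicator C u / 4 \<partial>lborel)"
    by (simp add: C_def emeasure_compact_finite)
  also have "\<dots> \<le> J e"
    unfolding J_def
  proof (rule integral_mono[OF _ max_int])
    show "integrable lborel (\<lambda>u. indicator C u / 4 :: real)"
      unfolding C_def by (auto intro!: integrable_real_indicator emeasure_compact_finite simp del: infinity_ennreal_def)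
    fix u
    show "indicator C u / 4 \<le> max 0 (e \<bullet> f u)"
    proof (cases "u \<in> C")
      case True
      then have d: "norm (e /\<^sub>R 2 - u) \<le> 1/4" by (simp add: C_def dist_norm)
      have "norm u \<le> 1"
        using norm_triangle_sub[of u "e /\<^sub>R 2"] d e by (simp add: norm_minus_commute)
      moreover have "e \<bullet> (e /\<^sub>R 2 - u) \<le> 1/4"
        using norm_cauchy_schwarz[of e "e /\<^sub>R 2 - u"] d e by simp
      moreover have "e \<bullet> e = 1" using e by (simp add: norm_eq_1)
      ultimately show ?thesis
        using True by (simp add: f_def inner_diff_right)
    qed simp
  qed
  finally show ?thesis
    using that[of "J e"] J unfolding J_def f_def by blast
qed

text \<open>
  Approximating the identity on the ball by a simple function in the mean replaces the integral by a finite
  sum. The error is uniform in \<open>a\<close> because \<open>\<lambda>u. max 0 (a \<bullet> u)\<close> is Lipschitz with constant \<open>norm a\<close>.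
\<close>

lemma norm_approx_sum_max_inner:
  assumes "0 < \<epsilon>"
  obtains I :: "(real ^ 'n) set" and w :: "real ^ 'n \<Rightarrow> real ^ 'n" where "finite I"
    "\<And>a. \<bar>(\<Sum>y\<in>I. max 0 (a \<bullet> w y)) - norm a\<bar> \<le> \<epsilon> * norm a"
proof -
  define f :: "real ^ 'n \<Rightarrow> real ^ 'n" where "f u = indicator (cball 0 1) u *\<^sub>R u" for u
  obtain c where "c > 0" and
    "\<And>a :: real ^ 'n. (\<integral>u. max 0 (a \<bullet> (indicator (cball 0 1) u *\<^sub>R u)) \<partial>lborel) = c * norm a"
    using integral_max_inner_cball[where 'n = 'n] by blast
  then have c: "c > 0" "\<And>a. (\<integral>u. max 0 (a \<bullet> f u) \<partial>lborel) = c * norm a"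
    by (simp_all only: f_def)
  have f_int: "integrable lborel f"
    unfolding f_def by (rule borel_integrable_compact) (auto intro: continuous_on_id)
  obtain x where "has_bochner_integral lborel f x"
    using f_int by (auto simp: integrable.simps)
  then obtain s where s: "\<And>i. Bochner_Integration.simple_bochner_integrable lborel (s i)"
    "(\<lambda>i. \<integral>\<^sup>+ u. norm (f u - s i u) \<partial>lborel) \<longlonglongrightarrow> 0"
    by (rule has_bochner_integral.cases) blast
  have "\<forall>\<^sub>F i in sequentially. (\<integral>\<^sup>+ u. norm (f u - s i u) \<partial>lborel) < ennreal (c * \<epsilon>)"
    using order_tendstoD(2)[OF s(2)] c(1) assms by (simp add: ennreal_less_zero_iff)
  then obtain i where i: "(\<integral>\<^sup>+ u. norm (f u - s i u) \<partial>lborel) < ennreal (c * \<epsilon>)"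
    by (auto simp: eventually_sequentially)
  define g where "g = s i"
  have g: "Bochner_Integration.simple_bochner_integrable lborel g" using s by (simp add: g_def)
  then have g_simple: "simple_function lborel g" and g_int: "integrable lborel g"
    by (auto elim: simple_bochner_integrable.cases intro: integrable.intros has_bochner_integral_simple_bochner_integrable)
  have diff_int: "integrable lborel (\<lambda>u. norm (f u - g u))"
    using f_int g_int by auto
  have "ennreal (\<integral>u. norm (f u - g u) \<partial>lborel) < ennreal (c * \<epsilon>)"
    using i nn_integral_eq_integral[OF diff_int] by (simp add: g_def)
  then have close: "(\<integral>u. norm (f u - g u) \<partial>lborel) < c * \<epsilon>"
    using c assms by (simp add: ennreal_less_iff)
  \<comment> \<open>The generators are the values of \<open>g\<close>, weighted by the measure of the sets where they are taken.\<close>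
  define I where "I = range g"
  define w where "w y = (measure lborel {u. g u = y} / c) *\<^sub>R y" for y
  have fin: "finite I" using g_simple by (auto simp: I_def simple_function_def)
  have main: "\<bar>(\<Sum>y\<in>I. max 0 (a \<bullet> w y)) - norm a\<bar> \<le> \<epsilon> * norm a" for a
  proof -
    have "Bochner_Integration.simple_bochner_integrable lborel (\<lambda>u. max 0 (a \<bullet> g u))"
      by (rule simple_bochner_integrable_compose2[OF _ g g, of "\<lambda>x y. max 0 (a \<bullet> x)"]) simp
    then have "(\<integral>u. max 0 (a \<bullet> g u) \<partial>lborel) = Bochner_Integration.simple_bochner_integral lborel (\<lambda>u. max 0 (a \<bullet> g u))"
      by (rule simple_bochner_integrable_eq_integral[symmetric])
    also have "\<dots> = (\<Sum>y\<in>I. measure lborel {u. g u = y} *\<^sub>R max 0 (a \<bullet> y))"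
      using simple_bochner_integral_partition[OF \<open>Bochner_Integration.simple_bochner_integrable lborel (\<lambda>u. max 0 (a \<bullet> g u))\<close> g_simple,
          of "\<lambda>y. max 0 (a \<bullet> y)"] by (simp add: I_def)
    also have "\<dots> = c * (\<Sum>y\<in>I. max 0 (a \<bullet> w y))"
      using c(1) by (simp add: sum_distrib_left w_def max_mult_distrib_left)
    finally have sum_eq: "c * (\<Sum>y\<in>I. max 0 (a \<bullet> w y)) = (\<integral>u. max 0 (a \<bullet> g u) \<partial>lborel)" ..
    have "\<bar>c * (\<Sum>y\<in>I. max 0 (a \<bullet> w y)) - c * norm a\<bar>
        = \<bar>\<integral>u. max 0 (a \<bullet> g u) - max 0 (a \<bullet> f u) \<partial>lborel\<bar>"
      unfolding sum_eq c(2)[symmetric] using f_int g_int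
      by (subst Bochner_Integration.integral_diff) (auto intro!: integrable_max)
    also have "\<dots> \<le> (\<integral>u. \<bar>max 0 (a \<bullet> g u) - max 0 (a \<bullet> f u)\<bar> \<partial>lborel)"
      by (rule integral_abs_bound)
    also have "\<dots> \<le> (\<integral>u. norm a * norm (f u - g u) \<partial>lborel)"
    proof (rule integral_mono)
      show "integrable lborel (\<lambda>u. \<bar>max 0 (a \<bullet> g u) - max 0 (a \<bullet> f u)\<bar>)"
        using f_int g_int by (intro integrable_abs Bochner_Integration.integrable_diff integrable_max) auto
      show "integrable lborel (\<lambda>u. norm a * norm (f u - g u))"
        using diff_int by simp
      fix u
      have "\<bar>max 0 (a \<bullet> g u) - max 0 (a \<bullet> f u)\<bar> \<le> \<bar>a \<bullet> (f u - g u)\<bar>"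
        by (auto simp: inner_diff_right)
      also have "\<dots> \<le> norm a * norm (f u - g u)"
        by (rule Cauchy_Schwarz_ineq2)
      finally show "\<bar>max 0 (a \<bullet> g u) - max 0 (a \<bullet> f u)\<bar> \<le> norm a * norm (f u - g u)" .
    qed
    also have "\<dots> \<le> norm a * (c * \<epsilon>)"
      using close by (simp add: mult_left_mono)
    finally have "c * \<bar>(\<Sum>y\<in>I. max 0 (a \<bullet> w y)) - norm a\<bar> \<le> c * (\<epsilon> * norm a)"
      using c(1) by (simp add: abs_mult mult_ac flip: right_diff_distrib)
    then show ?thesis using c(1) by simp
  qed
  show ?thesis by (rule that[OF fin main])
qed

text \<open>
  Inner products with \<open>a\<close> can be maximised on each segment separately, and there at one of the end points;
  the right-hand side is the support function of the zonotope.
\<close>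

lemma zonotope_support:
  fixes w :: "'i \<Rightarrow> 'a::real_inner"
  assumes "finite I"
  shows "z \<in> (\<Sum>j\<in>I. closed_segment 0 (w j)) \<Longrightarrow> a \<bullet> z \<le> (\<Sum>j\<in>I. max 0 (a \<bullet> w j))"
    and "\<exists>z\<in>(\<Sum>j\<in>I. closed_segment 0 (w j)). a \<bullet> z = (\<Sum>j\<in>I. max 0 (a \<bullet> w j))"
proof -
  assume "z \<in> (\<Sum>j\<in>I. closed_segment 0 (w j))"
  then obtain s where s: "z = sum s I" "\<And>j. j \<in> I \<Longrightarrow> s j \<in> closed_segment 0 (w j)"
    using assms by (auto simp: set_sum_alt)
  have "a \<bullet> s j \<le> max 0 (a \<bullet> w j)" if "j \<in> I" for j
  proof -
    from s(2)[OF that] obtain u where u: "0 \<le> u" "u \<le> 1" "s j = u *\<^sub>R w j"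
      by (auto simp: in_segment)
    then have "a \<bullet> s j = u * (a \<bullet> w j)" by simp
    also have "\<dots> \<le> u * max 0 (a \<bullet> w j)" using u by (intro mult_left_mono) auto
    also have "\<dots> \<le> max 0 (a \<bullet> w j)" using u by (intro mult_left_le_one_le) auto
    finally show ?thesis .
  qed
  then show "a \<bullet> z \<le> (\<Sum>j\<in>I. max 0 (a \<bullet> w j))"
    by (simp add: s(1) inner_sum_right sum_mono)
next
  define s where "s j = (if a \<bullet> w j \<ge> 0 then w j else 0)" for j
  have "s j \<in> closed_segment 0 (w j)" "a \<bullet> s j = max 0 (a \<bullet> w j)" for j
    by (auto simp: s_def)
  then show "\<exists>z\<in>(\<Sum>j\<in>I. closed_segment 0 (w j)). a \<bullet> z = (\<Sum>j\<in>I. max 0 (a \<bullet> w j))"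
    using assms by (intro bexI[of _ "sum s I"]) (auto simp: set_sum_alt inner_sum_right)
qed

text \<open>
  Closeness of support functions gives inclusions of sets: for the outer ball by testing a point of the
  zonotope against itself, for the inner ball by a hyperplane that separates a missing point.
\<close>

lemma zonotope_approx_cball:
  assumes "0 < \<epsilon>" "\<epsilon> < 1"
  obtains I :: "(real ^ 'n) set" and w :: "real ^ 'n \<Rightarrow> real ^ 'n" where "finite I"
    "cball 0 (1 - \<epsilon>) \<subseteq> (\<Sum>j\<in>I. closed_segment 0 (w j))"
    "(\<Sum>j\<in>I. closed_segment 0 (w j)) \<subseteq> cball 0 (1 + \<epsilon>)"
proof -
  obtain I :: "(real ^ 'n) set" and w :: "real ^ 'n \<Rightarrow> real ^ 'n" where I: "finite I"
    and w: "\<And>a. \<bar>(\<Sum>y\<in>I. max 0 (a \<bullet> w y)) - norm a\<bar> \<le> \<epsilon> * norm a"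
    using norm_approx_sum_max_inner[OF \<open>0 < \<epsilon>\<close>] by blast
  define Z where "Z = (\<Sum>j\<in>I. closed_segment 0 (w j))"
  have Z: "compact Z" "convex Z"
    unfolding Z_def by (auto intro!: compact_set_sum convex_set_sum)
  have "Z \<subseteq> cball 0 (1 + \<epsilon>)"
  proof
    fix z assume "z \<in> Z"
    then have "norm z * norm z \<le> (1 + \<epsilon>) * norm z"
      using zonotope_support(1)[OF I, of z w z] w[of z]
      by (simp add: Z_def algebra_simps flip: power2_norm_eq_inner power2_eq_square)
    then show "z \<in> cball 0 (1 + \<epsilon>)"
      using \<open>0 < \<epsilon>\<close> by (cases "z = 0") auto
  qed
  moreover have "cball 0 (1 - \<epsilon>) \<subseteq> Z"
  proof (rule ccontr)
    assume "\<not> cball 0 (1 - \<epsilon>) \<subseteq> Z"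
    then obtain x where x: "norm x \<le> 1 - \<epsilon>" "x \<notin> Z"
      unfolding subset_iff by auto
    then obtain a b where ab: "a \<bullet> x < b" "\<And>z. z \<in> Z \<Longrightarrow> b < a \<bullet> z"
      using separating_hyperplane_closed_point[OF Z(2) compact_imp_closed[OF Z(1)]] by blast
    obtain z where z: "z \<in> Z" "- a \<bullet> z = (\<Sum>j\<in>I. max 0 (- a \<bullet> w j))"
      using zonotope_support(2)[OF I, of w "- a"] unfolding Z_def by blast
    have "(1 - \<epsilon>) * norm a \<le> - (a \<bullet> z)"
      using w[of "- a"] z(2) by (simp add: algebra_simps)
    also have "\<dots> < - (a \<bullet> x)" using ab(1) ab(2)[OF z(1)] by simp
    also have "\<dots> \<le> norm a * norm x"
      using Cauchy_Schwarz_ineq2[of a x] by simp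
    also have "\<dots> \<le> (1 - \<epsilon>) * norm a"
      using x(1) by (simp add: mult.commute mult_left_mono)
    finally show False by simp
  qed
  ultimately show ?thesis
    using that[OF I, of w] by (simp add: Z_def)
qed

section \<open>Steiner's formula\<close>

text \<open>
  The coefficients of a polynomial of degree at most \<open>n\<close> are fixed linear combinations of its values at
  \<open>0, \<dots>, n\<close>; the weights \<open>a i j\<close> are the coefficients of the Lagrange basis polynomials. This is used three
  times: to pass to the limit in the coefficients, for the uniqueness of the quermassintegrals, and for
  their measurability along the superlevel sets of a function.
\<close>

lemma vandermonde_inverse:
  fixes n :: nat
  obtains a :: "nat \<Rightarrow> nat \<Rightarrow> real"
  where "\<And>c i. i \<le> n \<Longrightarrow> c i = (\<Sum>j\<le>n. a i j * (\<Sum>k\<le>n. c k * real j ^ k))"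
proof -
  define L where "L j = (\<Prod>m\<in>{..n} - {j}. smult (1 / (real j - real m)) [:- real m, 1:])" for j
  have deg_L: "degree (L j) \<le> n" if "j \<le> n" for j
  proof -
    have "degree (L j) \<le> (\<Sum>m\<in>{..n} - {j}. degree (smult (1 / (real j - real m)) [:- real m, 1:]))"
      unfolding L_def by (rule order.trans[OF degree_prod_sum_le]) auto
    also have "\<dots> \<le> (\<Sum>m\<in>{..n} - {j}. 1)" by (intro sum_mono) auto
    also have "\<dots> = n" using that by simp
    finally show ?thesis .
  qed
  have poly_L: "poly (L j) (real m) = (if m = j then 1 else 0)" if "m \<le> n" for j m
  proof (cases "m = j")
    case True
    then show ?thesis
      by (auto simp: L_def poly_prod simp flip: diff_divide_distrib intro!: prod.neutral)
  next
    case False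
    then show ?thesis using that by (auto simp: L_def poly_prod)
  qed
  have "c i = (\<Sum>j\<le>n. coeff (L j) i * (\<Sum>k\<le>n. c k * real j ^ k))" if "i \<le> n" for c i
  proof -
    define p where "p = (\<Sum>k\<le>n. monom (c k) k)"
    define q where "q = (\<Sum>j\<le>n. smult (poly p (real j)) (L j))"
    have "degree p \<le> n" "degree q \<le> n"
      unfolding p_def q_def
      by (auto intro!: degree_sum_le order.trans[OF degree_monom_le] order.trans[OF degree_smult_le] deg_L)
    then have deg: "degree (p - q) \<le> n" by (rule degree_diff_le)
    have roots: "real ` {..n} \<subseteq> {x. poly (p - q) x = 0}"
      by (auto simp: q_def poly_sum poly_L if_distrib cong: if_cong)
    have "p - q = 0"
    proof (rule ccontr)
      assume "p - q \<noteq> 0"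
      have "Suc n = card (real ` {..n})" by (simp add: card_image)
      also have "\<dots> \<le> card {x. poly (p - q) x = 0}"
        using \<open>p - q \<noteq> 0\<close> roots by (intro card_mono poly_roots_finite)
      also have "\<dots> \<le> n" using card_poly_roots_bound[OF \<open>p - q \<noteq> 0\<close>] deg by simp
      finally show False by simp
    qed
    then have "coeff p i = coeff q i" by simp
    moreover have "coeff p i = c i" using that by (simp add: p_def coeff_sum)
    moreover have "coeff q i = (\<Sum>j\<le>n. coeff (L j) i * (\<Sum>k\<le>n. c k * real j ^ k))"
      by (simp add: q_def coeff_sum p_def poly_sum poly_monom mult.commute)
    ultimately show ?thesis by simp
  qed
  then show ?thesis using that[of "\<lambda>i j. coeff (L j) i"] by blast
qed

lemma scaleR_image_cball_zero:
  fixes \<rho> :: real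
  assumes "0 \<le> \<rho>"
  shows "(\<lambda>x. \<rho> *\<^sub>R x) ` cball 0 1 = (cball 0 \<rho> :: 'a::real_normed_vector set)"
proof (cases "\<rho> = 0")
  case True
  have "(0::'a) \<in> cball 0 1" by simp
  then have "cball 0 1 \<noteq> ({} :: 'a set)" by blast
  with True show ?thesis by (simp add: image_constant_conv)
next
  case False
  then show ?thesis using assms cball_scale[of \<rho> "0::'a" 1] by simp
qed

lemma scaleR_image_set_plus:
  fixes A B :: "'a::real_vector set"
  shows "(\<lambda>x. \<rho> *\<^sub>R x) ` A + (\<lambda>x. \<rho> *\<^sub>R x) ` B = (\<lambda>x. \<rho> *\<^sub>R x) ` (A + B)"
proof (intro equalityI subsetI)
  fix z assume "z \<in> (\<lambda>x. \<rho> *\<^sub>R x) ` A + (\<lambda>x. \<rho> *\<^sub>R x) ` B"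
  then obtain x y where "x \<in> A" "y \<in> B" "z = \<rho> *\<^sub>R (x + y)"
    by (auto simp: set_plus_def scaleR_add_right)
  then show "z \<in> (\<lambda>x. \<rho> *\<^sub>R x) ` (A + B)" by blast
next
  fix z assume "z \<in> (\<lambda>x. \<rho> *\<^sub>R x) ` (A + B)"
  then obtain x y where "x \<in> A" "y \<in> B" "z = \<rho> *\<^sub>R x + \<rho> *\<^sub>R y"
    by (auto simp: set_plus_def scaleR_add_right)
  then show "z \<in> (\<lambda>x. \<rho> *\<^sub>R x) ` A + (\<lambda>x. \<rho> *\<^sub>R x) ` B" by blast
qed

lemma zonotope_scaleR:
  fixes w :: "'i \<Rightarrow> 'a::real_vector"
  shows "(\<Sum>j\<in>I. closed_segment 0 (\<rho> *\<^sub>R w j)) = (\<lambda>x. \<rho> *\<^sub>R x) ` (\<Sum>j\<in>I. closed_segment 0 (w j))"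
proof -
  have "closed_segment 0 (\<rho> *\<^sub>R w j) = (\<lambda>x. \<rho> *\<^sub>R x) ` closed_segment 0 (w j)" for j
    using closed_segment_linear_image[of "\<lambda>x. \<rho> *\<^sub>R x" 0 "w j"] by simp
  then show ?thesis
    using sum_set_linear[of "image (\<lambda>x. \<rho> *\<^sub>R x)" "\<lambda>j. closed_segment 0 (w j)" I]
    by (simp add: scaleR_image_set_plus comp_def)
qed

text \<open>
  Every monomial grows at most by the factor \<open>s ^ n\<close>. This is how a small relative change of a radius turns
  into a small relative change of the volume.
\<close>

lemma poly_scale_le:
  fixes p :: "real poly"
  assumes "\<And>i. 0 \<le> coeff p i" "degree p \<le> n" "1 \<le> s" "0 \<le> x"
  shows "poly p (s * x) \<le> s ^ n * poly p x"
proof -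
  have "coeff p i * (s * x) ^ i \<le> s ^ n * (coeff p i * x ^ i)" if "i \<le> degree p" for i
  proof -
    have "s ^ i * (coeff p i * x ^ i) \<le> s ^ n * (coeff p i * x ^ i)"
      using assms that by (intro mult_right_mono power_increasing) auto
    then show ?thesis by (simp add: power_mult_distrib mult_ac)
  qed
  then show ?thesis
    by (auto simp: poly_altdef sum_distrib_left intro!: sum_mono)
qed

text \<open>
  For a zonotope \<open>Z\<close> between the balls of radius \<open>1 - \<epsilon>\<close> and \<open>1 + \<epsilon>\<close>, the polynomial is the volume of
  \<open>K + \<rho> Z\<close>, which lies between the volumes of the parallel bodies of radius \<open>\<rho> (1 - \<epsilon>)\<close> and
  \<open>\<rho> (1 + \<epsilon>)\<close>. Rescaling \<open>\<rho>\<close> moves the error from the radius to a factor in front of the volume.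
\<close>

lemma parallel_volume_approx:
  fixes K :: "(real ^ 'n) set"
  assumes K: "compact K" "convex K" and \<epsilon>: "0 < \<epsilon>" "\<epsilon> < 1"
  shows "\<exists>p. degree p \<le> CARD('n) \<and> (\<forall>i. 0 \<le> coeff p i) \<and> (\<forall>\<rho>\<ge>0.
    (1 - \<epsilon>) ^ CARD('n) * measure lborel (K + cball 0 \<rho>) \<le> poly p \<rho> \<and>
    poly p \<rho> \<le> (1 + \<epsilon>) ^ CARD('n) * measure lborel (K + cball 0 \<rho>))"
proof -
  define n where "n = CARD('n)"
  define F where "F \<rho> = measure lborel (K + cball 0 \<rho>)" for \<rho>
  obtain I :: "(real ^ 'n) set" and w :: "real ^ 'n \<Rightarrow> real ^ 'n" where I: "finite I"
    and lower: "cball 0 (1 - \<epsilon>) \<subseteq> (\<Sum>j\<in>I. closed_segment 0 (w j))"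
    and upper: "(\<Sum>j\<in>I. closed_segment 0 (w j)) \<subseteq> cball 0 (1 + \<epsilon>)"
    using zonotope_approx_cball[OF \<epsilon>] by blast
  define Z where "Z \<rho> = (\<Sum>j\<in>I. closed_segment 0 (\<rho> *\<^sub>R w j))" for \<rho>
  obtain p where p: "\<And>i. 0 \<le> coeff p i" "\<And>\<rho>. 0 \<le> \<rho> \<Longrightarrow> measure lborel (K + Z \<rho>) = poly p \<rho>"
    using segment_affine_polynomial[OF I segment_affine_volume K, of w] unfolding Z_def by blast
  have scaled: "(\<lambda>x. \<rho> *\<^sub>R x) ` cball 0 r = (cball 0 (\<rho> * r) :: (real ^ 'n) set)" if "0 \<le> \<rho>" "0 \<le> r" for \<rho> r
    unfolding scaleR_image_cball_zero[OF that(2), symmetric]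
      scaleR_image_cball_zero[OF mult_nonneg_nonneg[OF that], symmetric] by (simp add: image_image)
  have fin: "K + cball 0 \<rho> \<in> fmeasurable lborel" "K + Z \<rho> \<in> fmeasurable lborel" for \<rho>
    unfolding Z_def by (auto intro!: compact_in_fmeasurable_lborel compact_set_plus compact_set_sum K)
  have F_le: "F (\<rho> * (1 - \<epsilon>)) \<le> poly p \<rho>" and le_F: "poly p \<rho> \<le> F (\<rho> * (1 + \<epsilon>))" if "0 \<le> \<rho>" for \<rho>
  proof -
    have "Z \<rho> = (\<lambda>x. \<rho> *\<^sub>R x) ` (\<Sum>j\<in>I. closed_segment 0 (w j))"
      unfolding Z_def by (rule zonotope_scaleR)
    then have Z_bounds: "cball 0 (\<rho> * (1 - \<epsilon>)) \<subseteq> Z \<rho>" "Z \<rho> \<subseteq> cball 0 (\<rho> * (1 + \<epsilon>))"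
      using image_mono[OF lower, of "\<lambda>x. \<rho> *\<^sub>R x"] image_mono[OF upper, of "\<lambda>x. \<rho> *\<^sub>R x"] \<epsilon> that
      by (simp_all add: scaled)
    show "F (\<rho> * (1 - \<epsilon>)) \<le> poly p \<rho>"
      unfolding F_def p(2)[OF that, symmetric]
      by (rule measure_mono_fmeasurable[OF set_plus_mono2[OF subset_refl Z_bounds(1)] fmeasurableD[OF fin(1)] fin(2)])
    show "poly p \<rho> \<le> F (\<rho> * (1 + \<epsilon>))"
      unfolding F_def p(2)[OF that, symmetric]
      by (rule measure_mono_fmeasurable[OF set_plus_mono2[OF subset_refl Z_bounds(2)] fmeasurableD[OF fin(2)] fin(1)])
  qed
  obtain R where R: "0 < R" "\<And>x. x \<in> K \<Longrightarrow> norm x \<le> R"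
    using compact_imp_bounded[OF K(1)] unfolding bounded_pos by metis
  have deg: "degree p \<le> n"
  proof (rule degree_le_of_growth[OF p(1)])
    fix \<rho> :: real assume "1 \<le> \<rho>"
    have "K + cball 0 (\<rho> * (1 + \<epsilon>)) \<subseteq> cball 0 ((R + 2) * \<rho>)"
    proof
      fix z assume "z \<in> K + cball 0 (\<rho> * (1 + \<epsilon>))"
      then obtain x y where "z = x + y" "norm x \<le> R" "norm y \<le> \<rho> * (1 + \<epsilon>)"
        using R by (auto simp: set_plus_def)
      then have "norm z \<le> R + \<rho> * (1 + \<epsilon>)"
        using norm_triangle_ineq[of x y] by simp
      also have "\<dots> \<le> R * \<rho> + \<rho> * 2"
        using R \<open>1 \<le> \<rho>\<close> \<epsilon> by (intro add_mono mult_left_mono) (auto simp: mult_le_cancel_left1)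
      finally show "z \<in> cball 0 ((R + 2) * \<rho>)" by (simp add: algebra_simps)
    qed
    then have "F (\<rho> * (1 + \<epsilon>)) \<le> measure lborel (cball 0 ((R + 2) * \<rho>) :: (real ^ 'n) set)"
      unfolding F_def
      by (intro measure_mono_fmeasurable compact_in_fmeasurable_lborel fin[THEN fmeasurableD] compact_cball)
    then show "poly p \<rho> \<le> (unit_ball_vol n * (R + 2) ^ n) * \<rho> ^ n"
      using le_F[of \<rho>] \<open>1 \<le> \<rho>\<close> R by (simp add: content_cball n_def power_mult_distrib mult_ac)
  qed
  have "(1 - \<epsilon>) ^ n * F \<rho> \<le> poly p \<rho> \<and> poly p \<rho> \<le> (1 + \<epsilon>) ^ n * F \<rho>" if "0 \<le> \<rho>" for \<rho>
  proof
    have "F \<rho> \<le> poly p ((1 / (1 - \<epsilon>)) * \<rho>)"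
      using F_le[of "\<rho> / (1 - \<epsilon>)"] that \<epsilon> by simp
    also have "\<dots> \<le> (1 / (1 - \<epsilon>)) ^ n * poly p \<rho>"
      using \<epsilon> that by (intro poly_scale_le p deg) auto
    finally show "(1 - \<epsilon>) ^ n * F \<rho> \<le> poly p \<rho>"
      using \<epsilon> by (simp add: power_one_over field_simps)
    have "poly p \<rho> = poly p ((1 + \<epsilon>) * (\<rho> / (1 + \<epsilon>)))" using \<epsilon> by simp
    also have "\<dots> \<le> (1 + \<epsilon>) ^ n * poly p (\<rho> / (1 + \<epsilon>))"
      using \<epsilon> that by (intro poly_scale_le p deg) auto
    also have "poly p (\<rho> / (1 + \<epsilon>)) \<le> F \<rho>"
      using le_F[of "\<rho> / (1 + \<epsilon>)"] that \<epsilon> by simp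
    finally show "poly p \<rho> \<le> (1 + \<epsilon>) ^ n * F \<rho>" using \<epsilon> by simp
  qed
  then show ?thesis
    using p(1) deg unfolding n_def F_def by blast
qed

text \<open>
  A pointwise limit of polynomials of bounded degree is a polynomial, whose coefficients are the limits of
  the coefficients; so their signs survive.
\<close>

lemma steiner_formula:
  fixes K :: "(real ^ 'n) set"
  assumes K: "compact K" "convex K"
  obtains c where "\<And>i. 0 \<le> c i"
    "\<And>\<rho>. 0 \<le> \<rho> \<Longrightarrow> measure lborel (K + cball 0 \<rho>) = (\<Sum>i\<le>CARD('n). c i * \<rho> ^ i)"
proof -
  define n where "n = CARD('n)"
  define F where "F \<rho> = measure lborel (K + cball 0 \<rho>)" for \<rho>
  define e :: "nat \<Rightarrow> real" where "e k = 1 / (real k + 2)" for k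
  have e: "0 < e k" "e k < 1" for k by (auto simp: e_def)
  have e_lim: "e \<longlonglongrightarrow> 0" 
    unfolding e_def using LIMSEQ_ignore_initial_segment[OF lim_1_over_n, of 2] by (simp add: add.commute)
  have "\<forall>k. \<exists>p. degree p \<le> n \<and> (\<forall>i. 0 \<le> coeff p i) \<and>
    (\<forall>\<rho>\<ge>0. (1 - e k) ^ n * F \<rho> \<le> poly p \<rho> \<and> poly p \<rho> \<le> (1 + e k) ^ n * F \<rho>)"
    unfolding n_def F_def using parallel_volume_approx[OF K e] by blast
  then obtain p where deg: "\<And>k. degree (p k) \<le> n" and nonneg: "\<And>k i. 0 \<le> coeff (p k) i"
    and bounds: "\<And>k \<rho>. 0 \<le> \<rho> \<Longrightarrow> (1 - e k) ^ n * F \<rho> \<le> poly (p k) \<rho>"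
      "\<And>k \<rho>. 0 \<le> \<rho> \<Longrightarrow> poly (p k) \<rho> \<le> (1 + e k) ^ n * F \<rho>"
    by metis
  have poly_p: "poly (p k) \<rho> = (\<Sum>i\<le>n. coeff (p k) i * \<rho> ^ i)" for k \<rho>
  proof -
    have "poly (p k) \<rho> = (\<Sum>i\<le>degree (p k). coeff (p k) i * \<rho> ^ i)"
      by (rule poly_altdef)
    also have "\<dots> = (\<Sum>i\<le>n. coeff (p k) i * \<rho> ^ i)"
      using deg[of k] by (intro sum.mono_neutral_left) (auto simp: coeff_eq_0)
    finally show ?thesis .
  qed
  have lim: "(\<lambda>k. poly (p k) \<rho>) \<longlonglongrightarrow> F \<rho>" if "0 \<le> \<rho>" for \<rho>
  proof (rule tendsto_sandwich)
    have "(\<lambda>k. (1 - e k) ^ n * F \<rho>) \<longlonglongrightarrow> (1 - 0) ^ n * F \<rho>"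
      "(\<lambda>k. (1 + e k) ^ n * F \<rho>) \<longlonglongrightarrow> (1 + 0) ^ n * F \<rho>"
      by (intro tendsto_intros e_lim)+
    then show "(\<lambda>k. (1 - e k) ^ n * F \<rho>) \<longlonglongrightarrow> F \<rho>" "(\<lambda>k. (1 + e k) ^ n * F \<rho>) \<longlonglongrightarrow> F \<rho>"
      by simp_all
  qed (use bounds that in auto)
  obtain a :: "nat \<Rightarrow> nat \<Rightarrow> real"
    where a: "\<And>c i. i \<le> n \<Longrightarrow> c i = (\<Sum>j\<le>n. a i j * (\<Sum>k\<le>n. c k * real j ^ k))"
    using vandermonde_inverse[of n] by blast
  define c where "c i = (if i \<le> n then \<Sum>j\<le>n. a i j * F (real j) else 0)" for i
  have c_lim: "(\<lambda>k. coeff (p k) i) \<longlonglongrightarrow> c i" if "i \<le> n" for i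
  proof -
    have "(\<lambda>k. \<Sum>j\<le>n. a i j * poly (p k) (real j)) \<longlonglongrightarrow> (\<Sum>j\<le>n. a i j * F (real j))"
      by (intro tendsto_intros lim) simp
    then show ?thesis
      using that a[OF that, of "coeff (p _)"] by (simp add: c_def poly_p)
  qed
  have "0 \<le> c i" for i
    using c_lim[of i] nonneg by (cases "i \<le> n") (auto intro: LIMSEQ_le_const simp: c_def)
  moreover have "F \<rho> = (\<Sum>i\<le>n. c i * \<rho> ^ i)" if "0 \<le> \<rho>" for \<rho>
  proof (rule LIMSEQ_unique[OF lim[OF that]])
    show "(\<lambda>k. poly (p k) \<rho>) \<longlonglongrightarrow> (\<Sum>i\<le>n. c i * \<rho> ^ i)"
      unfolding poly_p by (intro tendsto_intros c_lim) simp
  qed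
  ultimately show ?thesis
    using that[of c] unfolding n_def F_def by blast
qed

section \<open>Quermassintegrals of convex bodies\<close>

lemma quermassintegral_eqI:
  fixes K :: "(real ^ 'n) set"
  assumes "K \<noteq> {}" "i \<le> CARD('n)"
    and c: "\<And>\<rho>. 0 \<le> \<rho> \<Longrightarrow> measure lborel (K + cball 0 \<rho>) = (\<Sum>i\<le>CARD('n). c i * \<rho> ^ i)"
  shows "of_nat (CARD('n) choose i) * quermassintegral i K = c i"
proof -
  define n where "n = CARD('n)"
  define w where "w i = (if i \<le> n then c i / of_nat (n choose i) else 0)" for i
  obtain a :: "nat \<Rightarrow> nat \<Rightarrow> real"
    where a: "\<And>c i. i \<le> n \<Longrightarrow> c i = (\<Sum>j\<le>n. a i j * (\<Sum>k\<le>n. c k * real j ^ k))"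
    using vandermonde_inverse[of n] by blast
  have "(THE w :: nat \<Rightarrow> real. (\<forall>i > n. w i = 0) \<and>
      (\<forall>\<rho> \<ge> 0. measure lborel (K + (\<lambda>x. \<rho> *\<^sub>R x) ` cball 0 1)
        = (\<Sum>i\<le>n. of_nat (n choose i) * w i * \<rho> ^ i))) = w"
  proof (rule the_equality)
    show "(\<forall>i > n. w i = 0) \<and> (\<forall>\<rho> \<ge> 0. measure lborel (K + (\<lambda>x. \<rho> *\<^sub>R x) ` cball 0 1)
        = (\<Sum>i\<le>n. of_nat (n choose i) * w i * \<rho> ^ i))"
      using c by (simp add: w_def scaleR_image_cball_zero n_def)
  next
    fix v :: "nat \<Rightarrow> real"
    assume v: "(\<forall>i > n. v i = 0) \<and> (\<forall>\<rho> \<ge> 0. measure lborel (K + (\<lambda>x. \<rho> *\<^sub>R x) ` cball 0 1)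
        = (\<Sum>i\<le>n. of_nat (n choose i) * v i * \<rho> ^ i))"
    have same_values: "(\<Sum>i\<le>n. of_nat (n choose i) * v i * real j ^ i) = (\<Sum>i\<le>n. c i * real j ^ i)" for j
      using v c[of "real j"] by (simp add: scaleR_image_cball_zero n_def)
    have "of_nat (n choose i) * v i = c i" if "i \<le> n" for i
      using a[OF that, of "\<lambda>i. of_nat (n choose i) * v i"] a[OF that, of c] by (simp add: same_values)
    then show "v = w"
      using v by (auto simp: w_def fun_eq_iff field_simps)
  qed
  then show ?thesis
    using assms(1,2) by (simp add: quermassintegral_def w_def flip: n_def)
qed

lemma quermassintegral_empty [simp]: "quermassintegral i {} = 0"
  by (simp add: quermassintegral_def)

lemma
  fixes K :: "(real ^ 'n) set"
  assumes K: "compact K" "convex K"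
  shows quermassintegral_nonneg: "i \<le> CARD('n) \<Longrightarrow> 0 \<le> quermassintegral i K"
    and steiner_quermassintegral: "0 \<le> \<rho> \<Longrightarrow> measure lborel (K + cball 0 \<rho>)
      = (\<Sum>i\<le>CARD('n). of_nat (CARD('n) choose i) * quermassintegral i K * \<rho> ^ i)"
proof -
  obtain c where c: "\<And>i. 0 \<le> c i"
    "\<And>\<rho>. 0 \<le> \<rho> \<Longrightarrow> measure lborel (K + cball 0 \<rho>) = (\<Sum>i\<le>CARD('n). c i * \<rho> ^ i)"
    using steiner_formula[OF K] by blast
  have eq: "of_nat (CARD('n) choose i) * quermassintegral i K = c i" if "i \<le> CARD('n)" "K \<noteq> {}" for i
    by (rule quermassintegral_eqI[OF that(2,1) c(2)])
  show "0 \<le> quermassintegral i K" if "i \<le> CARD('n)"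
  proof (cases "K = {}")
    case False
    have "0 \<le> real (CARD('n) choose i) * quermassintegral i K"
      using eq[OF that False] c(1)[of i] by simp
    moreover have "0 < real (CARD('n) choose i)" using that by simp
    ultimately show ?thesis by (simp add: zero_le_mult_iff)
  qed simp
  show "measure lborel (K + cball 0 \<rho>)
      = (\<Sum>i\<le>CARD('n). of_nat (CARD('n) choose i) * quermassintegral i K * \<rho> ^ i)" if "0 \<le> \<rho>"
  proof (cases "K = {}")
    case True
    then show ?thesis by (simp add: set_plus_def)
  next
    case False
    then show ?thesis using c(2)[OF that] by (simp add: eq)
  qed
qed

text \<open>
  The weights are the same for all \<open>K\<close>, so that measurability in a parameter passes from the volumes of
  parallel bodies to the quermassintegrals.
\<close>

lemma quermassintegral_linear_combination:
  fixes i :: nat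
  assumes "i \<le> CARD('n)"
  obtains b :: "nat \<Rightarrow> real" where "\<And>K :: (real ^ 'n) set. compact K \<Longrightarrow> convex K \<Longrightarrow>
    quermassintegral i K = (\<Sum>j\<le>CARD('n). b j * measure lborel (K + cball 0 (real j)))"
proof -
  define n where "n = CARD('n)"
  obtain a :: "nat \<Rightarrow> nat \<Rightarrow> real"
    where a: "\<And>c i. i \<le> n \<Longrightarrow> c i = (\<Sum>j\<le>n. a i j * (\<Sum>k\<le>n. c k * real j ^ k))"
    using vandermonde_inverse[of n] by blast
  have "quermassintegral i K = (\<Sum>j\<le>n. a i j / of_nat (n choose i) * measure lborel (K + cball 0 (real j)))"
    if "compact K" "convex K" for K :: "(real ^ 'n) set"
  proof -
    have "of_nat (n choose i) * quermassintegral i K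
        = (\<Sum>j\<le>n. a i j * (\<Sum>k\<le>n. of_nat (n choose k) * quermassintegral k K * real j ^ k))"
      using assms by (intro a) (simp add: n_def)
    also have "\<dots> = (\<Sum>j\<le>n. a i j * measure lborel (K + cball 0 (real j)))"
      by (simp add: steiner_quermassintegral[OF that] n_def)
    finally have "quermassintegral i K
        = (\<Sum>j\<le>n. a i j * measure lborel (K + cball 0 (real j))) / of_nat (n choose i)"
      using assms by (simp add: n_def nonzero_eq_divide_eq mult.commute)
    then show ?thesis by (simp add: sum_divide_distrib)
  qed
  then show ?thesis using that[of "\<lambda>j. a i j / of_nat (n choose i)"] unfolding n_def by blast
qed

section \<open>Superlevel sets of quasi-concave functions\<close>

lemma upper_semicontinuous_imp_open:
  assumes "upper_semicontinuous f"
  shows "open {y. f y < c}"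
proof (subst open_subopen, intro ballI)
  fix x assume "x \<in> {y. f y < c}"
  then have "\<forall>\<^sub>F y in nhds x. f y < c"
    using assms by (simp add: upper_semicontinuous_def)
  then show "\<exists>T. open T \<and> x \<in> T \<and> T \<subseteq> {y. f y < c}"
    by (auto simp: eventually_nhds subset_iff)
qed

lemma upper_semicontinuous_attains_sup:
  fixes f :: "'a::topological_space \<Rightarrow> ennreal"
  assumes f: "upper_semicontinuous f" and S: "compact S" "S \<noteq> {}"
  shows "\<exists>y\<in>S. \<forall>z\<in>S. f z \<le> f y"
proof (rule ccontr)
  assume "\<not> ?thesis"
  then have above: "\<forall>y\<in>S. \<exists>z\<in>S. f y < f z" by (auto simp: not_le)
  then have cover: "S \<subseteq> (\<Union>z\<in>S. {y. f y < f z})" by blast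
  obtain D where D: "D \<subseteq> S" "finite D" "S \<subseteq> (\<Union>z\<in>D. {y. f y < f z})"
    by (rule compactE_image[OF S(1) upper_semicontinuous_imp_open[OF f] cover])
  then have "D \<noteq> {}" using S(2) by auto
  then have "Max (f ` D) \<in> f ` D" using D(2) by simp
  then obtain z where z: "z \<in> D" "f z = Max (f ` D)" by auto
  obtain y where y: "y \<in> D" "f z < f y" using D(1,3) z(1) by blast
  have "f y \<le> f z" using D(2) y(1) unfolding z(2) by simp
  with y(2) show False by simp
qed

lemma Q_class_superlevel:
  fixes f :: "real ^ 'n \<Rightarrow> ennreal"
  assumes "f \<in> Q_class" "0 < a"
  shows "compact {x. a \<le> f x}" "convex {x. a \<le> f x}"
proof -
  have usc: "upper_semicontinuous f" and qc: "quasi_concave f" and lim: "(f \<longlongrightarrow> 0) at_infinity"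
    using assms(1) by (auto simp: Q_class_def)
  have "open {x. f x < a}" by (rule upper_semicontinuous_imp_open[OF usc])
  moreover have "{x. a \<le> f x} = - {x. f x < a}" by auto
  ultimately have "closed {x. a \<le> f x}" by (simp add: closed_Compl)
  moreover have "bounded {x. a \<le> f x}"
  proof -
    obtain b where "\<And>x. b \<le> norm x \<Longrightarrow> f x < a"
      using order_tendstoD(2)[OF lim assms(2)] by (auto simp: eventually_at_infinity)
    then have "{x. a \<le> f x} \<subseteq> cball 0 b" by (force simp: not_le[symmetric])
    then show ?thesis by (rule bounded_subset[OF bounded_cball])
  qed
  ultimately show "compact {x. a \<le> f x}" by (simp add: compact_eq_bounded_closed)
  show "convex {x. a \<le> f x}"
    unfolding convex_alt
  proof (intro ballI allI impI)
    fix x y and u :: real assume "x \<in> {x. a \<le> f x}" "y \<in> {x. a \<le> f x}" and u: "0 \<le> u \<and> u \<le> 1"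
    then have "a \<le> min (f x) (f y)" by simp
    also have "\<dots> \<le> f ((1 - u) *\<^sub>R x + u *\<^sub>R y)"
      using qc u by (simp add: quasi_concave_def)
    finally show "(1 - u) *\<^sub>R x + u *\<^sub>R y \<in> {x. a \<le> f x}" by simp
  qed
qed

text \<open>
  The link between the enlargement of functions and that of sets. As the supremum over a closed ball is
  attained, it reaches \<open>a\<close> at \<open>x\<close> exactly if some point of the superlevel set of \<open>f\<close> is at distance at most \<open>\<rho>\<close>.
\<close>

lemma superlevel_sup_enlargement:
  fixes f :: "real ^ 'n \<Rightarrow> ennreal"
  assumes f: "upper_semicontinuous f" and "0 \<le> \<rho>"
  shows "{x. a \<le> sup_enlargement \<rho> f x} = {x. a \<le> f x} + cball 0 \<rho>"
proof (intro equalityI subsetI)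
  fix x assume "x \<in> {x. a \<le> sup_enlargement \<rho> f x}"
  then have le: "a \<le> (SUP y\<in>cball x \<rho>. f y)" by (simp add: sup_enlargement_def)
  have "cball x \<rho> \<noteq> {}" using \<open>0 \<le> \<rho>\<close> by simp
  then obtain y where y: "y \<in> cball x \<rho>" "\<And>z. z \<in> cball x \<rho> \<Longrightarrow> f z \<le> f y"
    using upper_semicontinuous_attains_sup[OF f compact_cball] by blast
  have "a \<le> f y" using le y(2) by (meson SUP_least order.trans)
  then have "y \<in> {x. a \<le> f x}" by simp
  moreover have "x - y \<in> cball 0 \<rho>" using y(1) by (simp add: dist_norm norm_minus_commute)
  ultimately have "y + (x - y) \<in> {x. a \<le> f x} + cball 0 \<rho>"
    by (rule set_plus_intro)
  then show "x \<in> {x. a \<le> f x} + cball 0 \<rho>" by simp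
next
  fix x assume "x \<in> {x. a \<le> f x} + cball 0 \<rho>"
  then obtain y z where yz: "x = y + z" "a \<le> f y" "norm z \<le> \<rho>"
    by (auto simp: set_plus_def)
  then have "f y \<le> sup_enlargement \<rho> f x"
    unfolding sup_enlargement_def by (intro SUP_upper) (simp add: dist_norm)
  with yz(2) have "a \<le> sup_enlargement \<rho> f x" by (rule order.trans)
  then show "x \<in> {x. a \<le> sup_enlargement \<rho> f x}" by simp
qed

lemma sup_enlargement_borel_measurable:
  fixes f :: "real ^ 'n \<Rightarrow> ennreal"
  assumes "f \<in> Q_class" "0 \<le> \<rho>"
  shows "sup_enlargement \<rho> f \<in> borel_measurable borel"
proof (rule borel_measurableI_ge)
  fix a :: ennreal
  have usc: "upper_semicontinuous f" using assms(1) by (simp add: Q_class_def)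
  show "{x \<in> space borel. a \<le> sup_enlargement \<rho> f x} \<in> sets borel"
  proof (cases "a = 0")
    case False
    then have "compact ({x. a \<le> f x} + cball 0 \<rho>)"
      using assms by (intro compact_set_plus Q_class_superlevel) (auto simp: zero_less_iff_neq_zero)
    then show ?thesis
      by (simp add: superlevel_sup_enlargement[OF usc assms(2)] borel_compact)
  qed simp
qed

section \<open>Integration over the levels\<close>

lemma nn_integral_indicator_ennreal_le:
  "(\<integral>\<^sup>+ t\<in>{0::real<..}. indicator {t. ennreal t \<le> y} t \<partial>lborel) = y"
proof (cases y)
  case (real r)
  have "(\<integral>\<^sup>+ t\<in>{0::real<..}. indicator {t. ennreal t \<le> y} t \<partial>lborel) = (\<integral>\<^sup>+ t. indicator {0<..r} t \<partial>lborel)"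
    by (intro nn_integral_cong) (auto simp: indicator_def real)
  then show ?thesis using real by simp
next
  case top
  have "(\<integral>\<^sup>+ t\<in>{0::real<..}. indicator {t. ennreal t \<le> y} t \<partial>lborel) = (\<integral>\<^sup>+ t. indicator {0::real<..} t \<partial>lborel)"
    by (intro nn_integral_cong) (auto simp: indicator_def top)
  also have "\<dots> = emeasure lborel {0::real<..}" by simp
  also have "\<dots> = top"
  proof (rule ccontr)
    assume "emeasure lborel {0::real<..} \<noteq> top"
    then obtain m :: nat where m: "emeasure lborel {0::real<..} < of_nat m"
      using ennreal_Ex_less_of_nat[of "emeasure lborel {0::real<..}"] by (auto simp: less_top)
    have "of_nat m = emeasure lborel {0<..real m}" by (simp add: ennreal_of_nat_eq_real_of_nat)
    also have "\<dots> \<le> emeasure lborel {0::real<..}" by (intro emeasure_mono) auto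
    finally show False using m by simp
  qed
  finally show ?thesis by (simp add: top)
qed

lemma superlevel_pairs_measurable:
  fixes g :: "'a::euclidean_space \<Rightarrow> ennreal"
  assumes [measurable]: "g \<in> borel_measurable borel"
  shows "{(t, x). ennreal t \<le> g x} \<in> sets (lborel \<Otimes>\<^sub>M lborel)"
proof -
  have "{z \<in> space (lborel \<Otimes>\<^sub>M lborel). ennreal (fst z) \<le> g (snd z)} \<in> sets (lborel \<Otimes>\<^sub>M (lborel :: 'a measure))"
    by measurable
  then show ?thesis by (simp add: space_pair_measure case_prod_unfold)
qed

lemma measure_superlevel_measurable:
  fixes g :: "'a::euclidean_space \<Rightarrow> ennreal"
  assumes "g \<in> borel_measurable borel"
  shows "(\<lambda>t. emeasure lborel {x. ennreal t \<le> g x}) \<in> borel_measurable borel"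
    and "(\<lambda>t. measure lborel {x. ennreal t \<le> g x}) \<in> borel_measurable borel"
proof -
  show em: "(\<lambda>t. emeasure lborel {x. ennreal t \<le> g x}) \<in> borel_measurable borel"
    using lborel.measurable_emeasure_Pair[OF superlevel_pairs_measurable[OF assms]]
    by (simp add: vimage_def)
  show "(\<lambda>t. measure lborel {x. ennreal t \<le> g x}) \<in> borel_measurable borel"
    unfolding measure_def using em by measurable
qed

lemma layer_cake:
  fixes g :: "'a::euclidean_space \<Rightarrow> ennreal"
  assumes [measurable]: "g \<in> borel_measurable borel"
  shows "(\<integral>\<^sup>+ x. g x \<partial>lborel) = (\<integral>\<^sup>+ t\<in>{0::real<..}. emeasure lborel {x. ennreal t \<le> g x} \<partial>lborel)"
proof -
  note [measurable] = superlevel_pairs_measurable[OF assms]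
  have "(\<integral>\<^sup>+ x. g x \<partial>lborel)
      = (\<integral>\<^sup>+ x. \<integral>\<^sup>+ t. indicator {(t, x). ennreal t \<le> g x} (t, x) * indicator {0<..} t \<partial>lborel \<partial>lborel)"
    by (subst nn_integral_indicator_ennreal_le[symmetric]) (simp add: indicator_def)
  also have "\<dots> = (\<integral>\<^sup>+ t. \<integral>\<^sup>+ x. indicator {(t, x). ennreal t \<le> g x} (t, x) * indicator {0<..} t \<partial>lborel \<partial>lborel)"
    by (rule lborel_pair.Fubini') simp
  also have "\<dots> = (\<integral>\<^sup>+ t\<in>{0::real<..}. emeasure lborel {x. ennreal t \<le> g x} \<partial>lborel)"
  proof (rule nn_integral_cong)
    fix t :: real
    have "(\<integral>\<^sup>+ x. indicator {(t, x). ennreal t \<le> g x} (t, x) * indicator {0<..} t \<partial>lborel)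
        = (\<integral>\<^sup>+ x. indicator {x. ennreal t \<le> g x} x * indicator {0<..} t \<partial>lborel)"
      by (simp add: indicator_def)
    also have "\<dots> = emeasure lborel {x. ennreal t \<le> g x} * indicator {0<..} t"
      by (subst nn_integral_multc) simp_all
    finally show "(\<integral>\<^sup>+ x. indicator {(t, x). ennreal t \<le> g x} (t, x) * indicator {0<..} t \<partial>lborel)
        = emeasure lborel {x. ennreal t \<le> g x} * indicator {0<..} t" .
  qed
  finally show ?thesis .
qed

text \<open>
  By \<open>quermassintegral_linear_combination\<close> it suffices to treat the volumes of the parallel bodies of integer
  radius \<open>j\<close>. These are the volumes of the superlevel sets of \<open>sup_enlargement j f\<close>, which depend
  measurably on the level by the Fubini theorem.
\<close>

lemma quermassintegral_superlevel_measurable: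
  fixes f :: "real ^ 'n \<Rightarrow> ennreal"
  assumes f: "f \<in> Q_class" and i: "i \<le> CARD('n)"
  shows "(\<lambda>t. ennreal (quermassintegral i {x. ennreal t \<le> f x}) * indicator {0<..} t) \<in> borel_measurable borel"
proof -
  obtain b where b: "\<And>K :: (real ^ 'n) set. compact K \<Longrightarrow> convex K \<Longrightarrow>
    quermassintegral i K = (\<Sum>j\<le>CARD('n). b j * measure lborel (K + cball 0 (real j)))"
    using quermassintegral_linear_combination[OF i] by blast
  have usc: "upper_semicontinuous f" using f by (simp add: Q_class_def)
  have [measurable]: "(\<lambda>t. measure lborel {x. ennreal t \<le> sup_enlargement (real j) f x}) \<in> borel_measurable borel" for j
    by (intro measure_superlevel_measurable sup_enlargement_borel_measurable f) simp
  have "(\<lambda>t. ennreal (quermassintegral i {x. ennreal t \<le> f x}) * indicator {0<..} t)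
      = (\<lambda>t. ennreal (\<Sum>j\<le>CARD('n). b j * measure lborel {x. ennreal t \<le> sup_enlargement (real j) f x})
             * indicator {0<..} t)"
    by (rule ext) (simp add: indicator_def b Q_class_superlevel[OF f] superlevel_sup_enlargement[OF usc])
  then show ?thesis by simp
qed

theorem theorem3p4:
  fixes f :: "real ^ 'n \<Rightarrow> ennreal" and \<rho> :: real
  assumes "f \<in> Q_class" and "\<rho> > 0"
  shows "I_fun (sup_enlargement \<rho> f)
    = (\<Sum>i\<le>CARD('n). of_nat (CARD('n) choose i) * quermassintegral_fun i f * ennreal (\<rho> ^ i))"
proof -
  define n where "n = CARD('n)"
  define L where "L t = {x. ennreal t \<le> f x}" for t
  have usc: "upper_semicontinuous f" using assms(1) by (simp add: Q_class_def)
  have level: "emeasure lborel {x. ennreal t \<le> sup_enlargement \<rho> f x}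
      = (\<Sum>i\<le>n. of_nat (n choose i) * ennreal (quermassintegral i (L t)) * ennreal (\<rho> ^ i))" if "0 < t" for t
  proof -
    have L: "compact (L t)" "convex (L t)"
      unfolding L_def using Q_class_superlevel[OF assms(1), of "ennreal t"] that by simp_all
    have "emeasure lborel {x. ennreal t \<le> sup_enlargement \<rho> f x} = emeasure lborel (L t + cball 0 \<rho>)"
      using superlevel_sup_enlargement[OF usc] assms(2) by (simp add: L_def)
    also have "\<dots> = ennreal (measure lborel (L t + cball 0 \<rho>))"
      by (intro emeasure_eq_measure2 compact_in_fmeasurable_lborel compact_set_plus L compact_cball)
    also have "\<dots> = ennreal (\<Sum>i\<le>n. of_nat (n choose i) * quermassintegral i (L t) * \<rho> ^ i)"
      using steiner_quermassintegral[OF L, of \<rho>] assms(2) by (simp add: n_def)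
    also have "\<dots> = (\<Sum>i\<le>n. of_nat (n choose i) * ennreal (quermassintegral i (L t)) * ennreal (\<rho> ^ i))"
      using quermassintegral_nonneg[OF L] assms(2)
      by (subst sum_ennreal[symmetric]) (auto simp: n_def ennreal_mult ennreal_of_nat_eq_real_of_nat)
    finally show ?thesis .
  qed
  have meas: "(\<lambda>t. ennreal (quermassintegral i (L t)) * indicator {0<..} t) \<in> borel_measurable borel"
    if "i \<le> n" for i
    unfolding L_def using that by (intro quermassintegral_superlevel_measurable assms(1)) (simp add: n_def)
  have "I_fun (sup_enlargement \<rho> f)
      = (\<integral>\<^sup>+ t\<in>{0<..}. emeasure lborel {x. ennreal t \<le> sup_enlargement \<rho> f x} \<partial>lborel)"
    unfolding I_fun_def using assms by (intro layer_cake sup_enlargement_borel_measurable) simp_all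
  also have "\<dots> = (\<integral>\<^sup>+ t. (\<Sum>i\<le>n. of_nat (n choose i) * (ennreal (quermassintegral i (L t)) * indicator {0<..} t)
      * ennreal (\<rho> ^ i)) \<partial>lborel)"
    by (intro nn_integral_cong) (simp add: indicator_def level)
  also have "\<dots> = (\<Sum>i\<le>n. of_nat (n choose i) * quermassintegral_fun i f * ennreal (\<rho> ^ i))"
  proof (subst nn_integral_sum)
    fix i assume "i \<in> {..n}"
    then have [measurable]: "(\<lambda>t. ennreal (quermassintegral i (L t)) * indicator {0<..} t) \<in> borel_measurable borel"
      by (intro meas) simp
    show "(\<lambda>t. of_nat (n choose i) * (ennreal (quermassintegral i (L t)) * indicator {0<..} t) * ennreal (\<rho> ^ i))
      \<in> borel_measurable lborel"
      by measurable
  next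
    show "(\<Sum>i\<le>n. \<integral>\<^sup>+ t. of_nat (n choose i) * (ennreal (quermassintegral i (L t)) * indicator {0<..} t)
        * ennreal (\<rho> ^ i) \<partial>lborel)
      = (\<Sum>i\<le>n. of_nat (n choose i) * quermassintegral_fun i f * ennreal (\<rho> ^ i))"
    proof (rule sum.cong[OF refl])
      fix i assume "i \<in> {..n}"
      then have [measurable]: "(\<lambda>t. ennreal (quermassintegral i (L t)) * indicator {0<..} t) \<in> borel_measurable borel"
        by (intro meas) simp
      show "(\<integral>\<^sup>+ t. of_nat (n choose i) * (ennreal (quermassintegral i (L t)) * indicator {0<..} t)
          * ennreal (\<rho> ^ i) \<partial>lborel)
        = of_nat (n choose i) * quermassintegral_fun i f * ennreal (\<rho> ^ i)"
        by (subst nn_integral_multc, measurable, subst nn_integral_cmult, measurable)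
          (simp add: quermassintegral_fun_def L_def)
    qed
  qed
  finally show ?thesis by (simp add: n_def)
qed

end
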